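(* Let $X\subseteq\mathbb{R}^n$ be a convex set and let $f:\mathbb{R}^n\times\mathbb{R}_+\to\mathbb{R}$, $(\mathbf{x},t)\mapsto f(\mathbf{x};t)$, be a smooth strongly convex function which is twice differentiable and $m$-strongly convex in $\mathbf{x}\in X$ uniformly in $t$, and which has bounded derivatives; that is, for constants $m>0$, $L$, $C_0$ and for all $\mathbf{x}\in X$ and all $t\ge 0$, $$\nabla_{\mathbf{x}\mathbf{x}}f(\mathbf{x};t)\succeq m\mathbf{I},\qquad \|\nabla_{\mathbf{x}\mathbf{x}}f(\mathbf{x};t)\|\le L,\qquad \|\nabla_{t\mathbf{x}}f(\mathbf{x};t)\|\le C_0 .$$ Let $\mathbf{x}^*(t)=\arg\min_{\mathbf{x}\in X}f(\mathbf{x};t)$. Let $\{\mathbf{x}_k\}_{k\in\mathbb{N}}$ be the sequence generated from an arbitrary initial variable $\mathbf{x}_0$ by the C-FOPC method (defined in the context) with sampling period $h>0$, sampling times $t_k$, stepsizes $\alpha,\beta>0$, $P$ prediction steps and $C$ correction steps. Define $$\varrho_{\mathrm{P}}=\max\{|1-\alpha m|,|1-\alpha L|\},\qquad \varrho_{\mathrm{C}}=\max\{|1-\beta m|,|1-\beta L|\},$$ and choose the stepsizes such that $\alpha<2/L$ and $\beta<2/L$. Further, select the number of correction steps $C$ in such a way that $$\tau_0:=\varrho_{\mathrm{C}}^{C}\left[\varrho_{\mathrm{P}}^{P}+(\varrho_{\mathrm{P}}^{P}+1)\frac{2L}{m}\right]<1 .$$ Then the sequence $\{\|\mathbf{x}_k-\mathbf{x}^*(t_k)\|\}_{k\in\mathbb{N}}$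 converges linearly with rate $\tau_0$ to an asymptotical error bound, and $$\limsup_{k\to\infty}\|\mathbf{x}_k-\mathbf{x}^*(t_k)\|=O(\varrho_{\mathrm{C}}^{C}h).$$
   Context: $\|\cdot\|$ is the Euclidean norm and the induced matrix norm. $\nabla_{\mathbf{x}}f$ and $\nabla_{\mathbf{x}\mathbf{x}}f$ are the gradient and Hessian of $f$ with respect to $\mathbf{x}$, and $\nabla_{t\mathbf{x}}f\in\mathbb{R}^n$ is the partial derivative in $t$ of $\nabla_{\mathbf{x}}f$. $\mathbb{P}_X$ is the projection operator over $X$. The sampling times satisfy $t_k-t_{k-1}=h$ for $k\ge1$, with $t_0\ge0$. The optimizer $\mathbf{x}^*(t)$ is unique for each $t$. C-FOPC (Constrained First-Order Prediction-Correction) method: given an initial variable $\mathbf{x}_0$, stepsizes $\alpha,\beta>0$ and numbers of steps $P,C$, for $k=0,1,2,\dots$: (Prediction) set $\widehat{\mathbf{x}}^0=\mathbf{x}_k$; for $p=0,\dots,P-1$, $$\widehat{\mathbf{x}}^{p+1}=\mathbb{P}_X\big[\widehat{\mathbf{x}}^{p}-\alpha\big(\nabla_{\mathbf{x}\mathbf{x}}f(\mathbf{x}_k;t_k)(\widehat{\mathbf{x}}^{p}-\mathbf{x}_k)+h\,\nabla_{t\mathbf{x}}f(\mathbf{x}_k;t_k)+\nabla_{\mathbf{x}}f(\mathbf{x}_k;t_k)\big)\big];$$ set $\tilde{\mathbf{x}}_{k+1|k}=\widehat{\mathbf{x}}^{P}$. (Correction) reset $\widehat{\mathbf{x}}^0=\tilde{\mathbf{x}}_{k+1|k}$;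 for $c=0,\dots,C-1$, $$\widehat{\mathbf{x}}^{c+1}=\mathbb{P}_X\big[\widehat{\mathbf{x}}^{c}-\beta\nabla_{\mathbf{x}}f(\widehat{\mathbf{x}}^{c};t_{k+1})\big];$$ set $\mathbf{x}_{k+1}=\widehat{\mathbf{x}}^{C}$. Linear convergence of a nonnegative sequence $\{e_k\}$ with rate $\tau<1$ to an asymptotical error bound is meant in the sense $e_k\le\tau^k e_0+b\,\frac{1-\tau^k}{1-\tau}$ for all $k$, where $b\ge0$ does not depend on $k$ and $b/(1-\tau)$ is the asymptotical error bound, i.e. the quantity that is of the order stated for the limit superior.
   Formalization: X is assumed closed so that the projection exists, and the linear-convergence inequality from k=0 is proved for x_0 in X only (it can fail for x_0 outside X, where the derivative bounds are not assumed); the limsup bound is proved for arbitrary x_0. *)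

theory Defs
  imports "HOL-Analysis.Analysis"
begin

(* Positive semidefiniteness in the Loewner order, hence of symmetric matrices. *)
definition psd :: "real^'n^'n \<Rightarrow> bool" where
  "psd A \<longleftrightarrow> transpose A = A \<and> (\<forall>v. 0 \<le> v \<bullet> (A *v v))"

definition contraction_rate :: "real \<Rightarrow> real \<Rightarrow> real \<Rightarrow> real" where
  "contraction_rate \<gamma> m L = max \<bar>1 - \<gamma> * m\<bar> \<bar>1 - \<gamma> * L\<bar>"

definition tau0 :: "real \<Rightarrow> real \<Rightarrow> real \<Rightarrow> real \<Rightarrow> nat \<Rightarrow> nat \<Rightarrow> real" where
  "tau0 m L \<alpha> \<beta> P C = contraction_rate \<beta> m L ^ C *
     (contraction_rate \<alpha> m L ^ P + (contraction_rate \<alpha> m L ^ P + 1) * (2 * L / m))"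

(* In what follows G x t, H x t and D x t stand for the gradient, the Hessian and the time
   derivative of the gradient of f at (x, t).  On a nonempty closed convex set X,
   closest_point X is the Euclidean projection onto X. *)

definition prediction_step ::
  "(real^'n) set \<Rightarrow> (real^'n \<Rightarrow> real \<Rightarrow> real^'n) \<Rightarrow> (real^'n \<Rightarrow> real \<Rightarrow> real^'n^'n) \<Rightarrow>
   (real^'n \<Rightarrow> real \<Rightarrow> real^'n) \<Rightarrow> real \<Rightarrow> real \<Rightarrow> real^'n \<Rightarrow> real \<Rightarrow> real^'n \<Rightarrow> real^'n" where
  "prediction_step X G H D \<alpha> h x t y =
     closest_point X (y - \<alpha> *\<^sub>R (H x t *v (y - x) + h *\<^sub>R D x t + G x t))"

definition correction_step ::
  "(real^'n) set \<Rightarrow> (real^'n \<Rightarrow> real \<Rightarrow> real^'n) \<Rightarrow> real \<Rightarrow> real \<Rightarrow> real^'n \<Rightarrow> real^'n" where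
  "correction_step X G \<beta> t y = closest_point X (y - \<beta> *\<^sub>R G y t)"

primrec cfopc ::
  "(real^'n) set \<Rightarrow> (real^'n \<Rightarrow> real \<Rightarrow> real^'n) \<Rightarrow> (real^'n \<Rightarrow> real \<Rightarrow> real^'n^'n) \<Rightarrow>
   (real^'n \<Rightarrow> real \<Rightarrow> real^'n) \<Rightarrow> real \<Rightarrow> real \<Rightarrow> nat \<Rightarrow> nat \<Rightarrow> real \<Rightarrow> (nat \<Rightarrow> real) \<Rightarrow>
   real^'n \<Rightarrow> nat \<Rightarrow> real^'n" where
  "cfopc X G H D \<alpha> \<beta> P C h ts x0 0 = x0"
| "cfopc X G H D \<alpha> \<beta> P C h ts x0 (Suc k) =
     (let xk = cfopc X G H D \<alpha> \<beta> P C h ts x0 k;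
          xpred = (prediction_step X G H D \<alpha> h xk (ts k) ^^ P) xk
      in (correction_step X G \<beta> (ts (Suc k)) ^^ C) xpred)"

(* Linear convergence of e with rate \<tau> to the asymptotical error bound E = b / (1 - \<tau>). *)
definition converges_linearly_to_bound :: "(nat \<Rightarrow> real) \<Rightarrow> real \<Rightarrow> real \<Rightarrow> bool" where
  "converges_linearly_to_bound e \<tau> E \<longleftrightarrow> \<tau> < 1 \<and>
     (\<exists>b\<ge>0. E = b / (1 - \<tau>) \<and>
        (\<forall>k. e k \<le> \<tau> ^ k * e 0 + b * ((1 - \<tau> ^ k) / (1 - \<tau>))))"

end

theory Submission
  imports Defs
begin

text \<open>
  One period of the method is compared with two variational inequalities on \<open>X\<close>: the one solved by
  the optimizer at the new sampling time, whose operator is \<open>G\<close> at that time, and the one solved by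
  the exact minimizer \<open>z\<close> of the quadratic model that the prediction steps work on, whose operator
  is the model gradient \<open>Q\<close>.  Both kinds of steps are projected gradient steps.  Since the Hessian
  on \<open>X\<close> is symmetric with spectrum in \<open>[m, L]\<close>, the map \<open>I - \<gamma> H\<close> has norm at most
  \<open>contraction_rate \<gamma> m L\<close>, so each such step contracts towards the solution of its own variational
  inequality (\<open>gradient_step_norm_le\<close>, \<open>projected_steps_contract\<close>).

  The prediction therefore aims at \<open>z\<close> instead of the new optimizer \<open>x'\<close>, and the distance between
  these two is what has to be controlled.  Solutions of two variational inequalities differ by at
  most \<open>1 / m\<close> times the difference of the operators at one of the solutions, as soon as one operator
  is \<open>m\<close>-strongly monotone (\<open>vi_solution_perturbation\<close>).  At \<open>x'\<close> the operators differ by at most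
  \<open>2 L\<close> times the distance of \<open>x'\<close> from the current iterate (linearization in space) plus \<open>2 C0 h\<close>
  (linearization in time); this is the origin of the factor \<open>2 L / m\<close> in \<open>tau0\<close>.  The same
  perturbation bound shows that the optimizer moves by at most \<open>C0 h / m\<close> per period.  Together they
  give a recursion \<open>e (k + 1) \<le> \<tau> e k + b\<close> with \<open>\<tau> = tau0\<close> and \<open>b\<close> a constant multiple of
  \<open>contraction_rate \<beta> m L ^ C * h\<close> (\<open>error_step\<close>), and unrolling it gives linear convergence.

  Two points concern the uniformity of the constant.  The bound contains \<open>1 / (1 - \<tau>)\<close>, and \<open>\<tau>\<close>
  depends on \<open>C\<close>; but \<open>\<tau>\<close> decreases in \<open>C\<close>, so its value at the least admissible \<open>C\<close> serves for all
  of them (\<open>tau0_uniform_gap\<close>).  And an initial point outside \<open>X\<close> does not affect the limit superior: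
  \<open>\<tau> < 1\<close> forces at least one correction step, hence all later iterates lie in \<open>X\<close>.
\<close>

section \<open>Contraction of gradient steps\<close>

text \<open>
  For a self-adjoint operator the norm is controlled by the quadratic form alone: polarization
  expresses \<open>u \<bullet> A v\<close> by the values of the form at \<open>u + v\<close> and \<open>u - v\<close>, and \<open>u\<close> is taken parallel to
  \<open>A v\<close> and of the same length as \<open>v\<close>.
\<close>
lemma selfadjoint_norm_le:
  fixes A :: "'a::real_inner \<Rightarrow> 'a"
  assumes "linear A"
    and sym: "\<And>u v. u \<bullet> A v = A u \<bullet> v"
    and form: "\<And>v. \<bar>v \<bullet> A v\<bar> \<le> c * (norm v)\<^sup>2"
  shows "norm (A v) \<le> c * norm v"
proof (cases "A v = 0 \<or> v = 0")
  case True
  have "0 \<le> c * norm v"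
  proof (cases "v = 0")
    case False
    have "0 \<le> c * (norm v)\<^sup>2"
      using form[of v] by linarith
    with False show ?thesis
      by (simp add: zero_le_mult_iff)
  qed simp
  then show ?thesis
    using True \<open>linear A\<close> by (auto simp: linear_0)
next
  case False
  define u where "u = (norm v / norm (A v)) *\<^sub>R A v"
  have norm_u: "norm u = norm v"
    using False by (simp add: u_def)
  have "u \<bullet> A v = norm v * norm (A v)"
    using False by (simp add: u_def dot_square_norm power2_eq_square)
  moreover have "4 * (u \<bullet> A v) = (u + v) \<bullet> A (u + v) - (u - v) \<bullet> A (u - v)"
    using sym[of u v] by (simp add: linear_add[OF \<open>linear A\<close>] linear_diff[OF \<open>linear A\<close>]
        inner_add_left inner_add_right inner_diff_left inner_diff_right inner_commute)
  moreover have "\<dots> \<le> c * (norm (u + v))\<^sup>2 + c * (norm (u - v))\<^sup>2"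
    using form[of "u + v"] form[of "u - v"] by linarith
  moreover have "\<dots> = c * (4 * (norm v)\<^sup>2)"
  proof -
    have "(norm (u + v))\<^sup>2 + (norm (u - v))\<^sup>2 = 2 * (norm u)\<^sup>2 + 2 * (norm v)\<^sup>2"
      by (simp add: power2_norm_eq_inner inner_add_left inner_add_right
          inner_diff_left inner_diff_right inner_commute)
    then show ?thesis
      by (simp add: norm_u flip: distrib_left)
  qed
  ultimately have "norm v * norm (A v) \<le> norm v * (c * norm v)"
    by (simp add: power2_eq_square algebra_simps)
  then show ?thesis
    using False by simp
qed

lemma psd_diff_matD:
  fixes A :: "real^'n^'n"
  assumes "psd (A - mat m)"
  shows "u \<bullet> (A *v v) = (A *v u) \<bullet> v" "m * (norm v)\<^sup>2 \<le> v \<bullet> (A *v v)"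
proof -
  have mat: "mat m *v w = m *\<^sub>R w" for w :: "real^'n"
    by (simp add: vec_eq_iff matrix_vector_mult_def mat_def if_distrib[where f = "\<lambda>x. x * _"]
        cong: if_cong)
  have "u \<bullet> ((A - mat m) *v v) = ((A - mat m) *v u) \<bullet> v"
    using assms unfolding psd_def by (metis dot_lmul_matrix transpose_matrix_vector)
  then show "u \<bullet> (A *v v) = (A *v u) \<bullet> v"
    by (simp add: matrix_vector_mult_diff_rdistrib mat inner_diff_left inner_diff_right)
  have "0 \<le> v \<bullet> ((A - mat m) *v v)"
    using assms by (simp add: psd_def)
  then show "m * (norm v)\<^sup>2 \<le> v \<bullet> (A *v v)"
    by (simp add: matrix_vector_mult_diff_rdistrib mat inner_diff_right power2_norm_eq_inner)
qed

lemma norm_matrix_vector_le: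
  fixes A :: "real^'n^'n"
  assumes "onorm (\<lambda>v. A *v v) \<le> L"
  shows "norm (A *v v) \<le> L * norm v"
  using onorm[OF matrix_vector_mul_bounded_linear, of A v] assms
  by (meson mult_right_mono norm_ge_zero order_trans)

text \<open>
  The quadratic form of \<open>I - \<gamma> A\<close> lies between \<open>1 - \<gamma> L\<close> and \<open>1 - \<gamma> m\<close>.
\<close>
lemma gradient_step_norm_le:
  fixes A :: "real^'n^'n"
  assumes "psd (A - mat m)" and "onorm (\<lambda>v. A *v v) \<le> L" and "\<gamma> \<ge> 0"
  shows "norm (v - \<gamma> *\<^sub>R (A *v v)) \<le> contraction_rate \<gamma> m L * norm v"
proof (rule selfadjoint_norm_le[where A = "\<lambda>v. v - \<gamma> *\<^sub>R (A *v v)"])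
  show "linear (\<lambda>v. v - \<gamma> *\<^sub>R (A *v v))"
    by (intro linear_compose_sub linear_compose_scale_right linear_ident matrix_vector_mul_linear)
  show "u \<bullet> (v - \<gamma> *\<^sub>R (A *v v)) = (u - \<gamma> *\<^sub>R (A *v u)) \<bullet> v" for u v
    using psd_diff_matD(1)[OF assms(1), of u v] by (simp add: inner_diff_left inner_diff_right)
  fix v
  have "v \<bullet> (A *v v) \<le> norm v * norm (A *v v)"
    by (rule norm_cauchy_schwarz)
  also have "\<dots> \<le> norm v * (L * norm v)"
    by (intro mult_left_mono norm_matrix_vector_le assms) simp
  finally have upper: "v \<bullet> (A *v v) \<le> L * (norm v)\<^sup>2"
    by (simp add: power2_eq_square algebra_simps)
  have form: "v \<bullet> (v - \<gamma> *\<^sub>R (A *v v)) = (norm v)\<^sup>2 - \<gamma> * (v \<bullet> (A *v v))"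
    by (simp add: inner_diff_right power2_norm_eq_inner)
  have "(1 - \<gamma> * L) * (norm v)\<^sup>2 \<le> v \<bullet> (v - \<gamma> *\<^sub>R (A *v v))"
    using mult_left_mono[OF upper \<open>\<gamma> \<ge> 0\<close>] unfolding form by (simp add: algebra_simps)
  moreover have "v \<bullet> (v - \<gamma> *\<^sub>R (A *v v)) \<le> (1 - \<gamma> * m) * (norm v)\<^sup>2"
    using mult_left_mono[OF psd_diff_matD(2)[OF assms(1)] \<open>\<gamma> \<ge> 0\<close>] unfolding form
    by (simp add: algebra_simps)
  moreover have "(1 - \<gamma> * m) * (norm v)\<^sup>2 \<le> contraction_rate \<gamma> m L * (norm v)\<^sup>2"
    by (intro mult_right_mono) (auto simp: contraction_rate_def)
  moreover have "- contraction_rate \<gamma> m L * (norm v)\<^sup>2 \<le> (1 - \<gamma> * L) * (norm v)\<^sup>2"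
    by (intro mult_right_mono) (auto simp: contraction_rate_def)
  ultimately show "\<bar>v \<bullet> (v - \<gamma> *\<^sub>R (A *v v))\<bar> \<le> contraction_rate \<gamma> m L * (norm v)\<^sup>2"
    by simp
qed

lemma contraction_rate_nonneg: "0 \<le> contraction_rate \<gamma> m L"
  by (simp add: contraction_rate_def)

lemma contraction_rate_less_1:
  assumes "0 < m" "m \<le> L" "0 < \<gamma>" "\<gamma> < 2 / L"
  shows "contraction_rate \<gamma> m L < 1"
proof -
  have "\<gamma> * L < 2" "0 < \<gamma> * m" "\<gamma> * m \<le> \<gamma> * L"
    using assms by (simp_all add: field_simps)
  then show ?thesis
    by (auto simp: contraction_rate_def abs_if)
qed

section \<open>Variational inequalities and projected steps\<close>

definition solves_vi :: "'a::real_inner set \<Rightarrow> ('a \<Rightarrow> 'a) \<Rightarrow> 'a \<Rightarrow> bool" where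
  "solves_vi X S x \<longleftrightarrow> x \<in> X \<and> (\<forall>y\<in>X. 0 \<le> S x \<bullet> (y - x))"

text \<open>
  The first-order optimality condition: along the segment from \<open>x\<close> to another point of \<open>X\<close> the
  function cannot start with a negative slope.
\<close>
lemma minimizer_solves_vi:
  fixes f :: "'a::real_inner \<Rightarrow> real"
  assumes "convex X" and deriv: "GDERIV f x :> S x" and min: "is_arg_min f (\<lambda>y. y \<in> X) x"
  shows "solves_vi X S x"
  unfolding solves_vi_def
proof (intro conjI ballI)
  show x: "x \<in> X"
    using min by (simp add: is_arg_min_def)
  fix y assume y: "y \<in> X"
  show "0 \<le> S x \<bullet> (y - x)"
  proof (rule ccontr)
    assume neg: "\<not> 0 \<le> S x \<bullet> (y - x)"
    have "(f has_derivative (\<lambda>v. v \<bullet> S x)) (at (x + 0 *\<^sub>R (y - x)))"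
      using deriv by (simp add: gderiv_def)
    moreover have "((\<lambda>s. x + s *\<^sub>R (y - x)) has_derivative (\<lambda>s. s *\<^sub>R (y - x))) (at 0)"
      by (auto intro!: derivative_eq_intros)
    ultimately have "((\<lambda>s. f (x + s *\<^sub>R (y - x))) has_derivative (\<lambda>s. s *\<^sub>R (y - x) \<bullet> S x)) (at 0)"
      by (rule has_derivative_compose[rotated])
    then have "DERIV (\<lambda>s. f (x + s *\<^sub>R (y - x))) 0 :> (y - x) \<bullet> S x"
      by (simp add: has_field_derivative_def mult_commute_abs)
    then obtain d where d: "d > 0" "\<forall>s>0. s < d \<longrightarrow> f (x + s *\<^sub>R (y - x)) < f x"
      using DERIV_neg_dec_right[of "\<lambda>s. f (x + s *\<^sub>R (y - x))" "(y - x) \<bullet> S x" 0] neg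
      by (auto simp: inner_commute)
    (* s has to be below d for the decrease and at most 1 to stay on the segment *)
    define s where "s = min (d / 2) 1"
    have s: "0 < s" "s < d" "s \<le> 1"
      using d(1) by (auto simp: s_def)
    have "x + s *\<^sub>R (y - x) = (1 - s) *\<^sub>R x + s *\<^sub>R y"
      by (simp add: algebra_simps)
    then have "x + s *\<^sub>R (y - x) \<in> X"
      using \<open>convex X\<close> x y s by (simp add: convex_def)
    then show False
      using d(2) s min by (auto simp: is_arg_min_def)
  qed
qed

lemma solves_vi_iff_projection_fixed:
  fixes X :: "'a::euclidean_space set"
  assumes "convex X" "closed X" "x \<in> X" "\<gamma> > 0"
  shows "solves_vi X S x \<longleftrightarrow> closest_point X (x - \<gamma> *\<^sub>R S x) = x"
proof
  assume vi: "solves_vi X S x"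
  have "x = closest_point X (x - \<gamma> *\<^sub>R S x)"
  proof (rule closest_point_unique[OF assms(1-3)], rule ballI)
    fix y assume "y \<in> X"
    then have "0 \<le> \<gamma> * (S x \<bullet> (y - x))"
      using vi \<open>\<gamma> > 0\<close> by (simp add: solves_vi_def)
    then have "0 \<le> (\<gamma> *\<^sub>R S x) \<bullet> (y - x)"
      by simp
    then have "norm (\<gamma> *\<^sub>R S x) \<le> norm (\<gamma> *\<^sub>R S x + (y - x))"
      unfolding norm_le inner_add_left inner_add_right
      using inner_ge_zero[of "y - x"] inner_commute[of "\<gamma> *\<^sub>R S x" "y - x"] by linarith
    also have "\<dots> = dist (x - \<gamma> *\<^sub>R S x) y"
      by (subst dist_commute) (simp add: dist_norm algebra_simps)
    finally show "dist (x - \<gamma> *\<^sub>R S x) x \<le> dist (x - \<gamma> *\<^sub>R S x) y"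
      by (simp add: dist_norm)
  qed
  then show "closest_point X (x - \<gamma> *\<^sub>R S x) = x"
    by simp
next
  assume fixed: "closest_point X (x - \<gamma> *\<^sub>R S x) = x"
  have "0 \<le> S x \<bullet> (y - x)" if "y \<in> X" for y
    using closest_point_dot[OF assms(1,2) that, of "x - \<gamma> *\<^sub>R S x"] \<open>\<gamma> > 0\<close>
    unfolding fixed by (simp add: zero_le_mult_iff)
  then show "solves_vi X S x"
    using \<open>x \<in> X\<close> by (simp add: solves_vi_def)
qed

text \<open>
  Testing each of the two inequalities with the solution of the other and adding them bounds
  \<open>(S x - S y) \<bullet> (x - y)\<close> by \<open>(S' y - S y) \<bullet> (x - y)\<close>; strong monotonicity is used on the left, the
  Cauchy-Schwarz inequality on the right.
\<close>
lemma vi_solution_perturbation: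
  assumes "solves_vi X S x" "solves_vi X S' y"
    and mono: "m * (norm (x - y))\<^sup>2 \<le> (S x - S y) \<bullet> (x - y)"
  shows "m * norm (x - y) \<le> norm (S' y - S y)"
proof (cases "x = y")
  case False
  have "0 \<le> S x \<bullet> (y - x)" "0 \<le> S' y \<bullet> (x - y)"
    using assms(1,2) by (auto simp: solves_vi_def)
  then have "(S x - S y) \<bullet> (x - y) \<le> (S' y - S y) \<bullet> (x - y)"
    by (simp add: inner_diff_left inner_diff_right)
  also have "\<dots> \<le> norm (S' y - S y) * norm (x - y)"
    by (rule norm_cauchy_schwarz)
  finally have "norm (x - y) * (m * norm (x - y)) \<le> norm (x - y) * norm (S' y - S y)"
    using mono by (simp add: power2_eq_square algebra_simps)
  then show ?thesis
    using False by simp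
qed simp

text \<open>
  Strong monotonicity can be read off from any single contraction estimate with the factor
  \<open>1 - \<gamma> m\<close>.
\<close>
lemma strongly_monotone_if_contraction:
  fixes w z :: "'a::real_inner"
  assumes "\<gamma> > 0" and contr: "norm (z - \<gamma> *\<^sub>R w) \<le> (1 - \<gamma> * m) * norm z"
  shows "m * (norm z)\<^sup>2 \<le> w \<bullet> z"
proof -
  have "(norm z)\<^sup>2 - \<gamma> * (w \<bullet> z) = (z - \<gamma> *\<^sub>R w) \<bullet> z"
    by (simp add: inner_diff_left power2_norm_eq_inner)
  also have "\<dots> \<le> norm (z - \<gamma> *\<^sub>R w) * norm z"
    by (rule norm_cauchy_schwarz)
  also have "\<dots> \<le> (1 - \<gamma> * m) * norm z * norm z"
    by (intro mult_right_mono contr) simp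
  finally have "\<gamma> * (m * (norm z)\<^sup>2) \<le> \<gamma> * (w \<bullet> z)"
    by (simp add: power2_eq_square algebra_simps)
  then show ?thesis
    using \<open>\<gamma> > 0\<close> by simp
qed

text \<open>
  A projected step inherits the contraction factor of the step itself because the projection is
  nonexpansive.
\<close>
lemma projected_step_lipschitz:
  fixes X :: "'a::euclidean_space set"
  assumes "convex X" "closed X" "X \<noteq> {}"
    and "norm (y - x - \<gamma> *\<^sub>R (S y - S x)) \<le> \<rho> * norm (y - x)"
  shows "dist (closest_point X (y - \<gamma> *\<^sub>R S y)) (closest_point X (x - \<gamma> *\<^sub>R S x)) \<le> \<rho> * dist y x"
proof -
  have "dist (closest_point X (y - \<gamma> *\<^sub>R S y)) (closest_point X (x - \<gamma> *\<^sub>R S x))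
      \<le> dist (y - \<gamma> *\<^sub>R S y) (x - \<gamma> *\<^sub>R S x)"
    by (rule closest_point_lipschitz[OF assms(1-3)])
  also have "\<dots> = norm (y - x - \<gamma> *\<^sub>R (S y - S x))"
    by (simp add: dist_norm algebra_simps)
  finally show ?thesis
    using assms(4) by (simp add: dist_norm)
qed

text \<open>
  The solution of the variational inequality is a fixed point of the projected step, so each step
  shrinks the distance to it.
\<close>
lemma projected_steps_contract:
  fixes X :: "'a::euclidean_space set" and S :: "'a \<Rightarrow> 'a"
  assumes X: "convex X" "closed X" and "\<gamma> > 0" "\<rho> \<ge> 0"
    and vi: "solves_vi X S x"
    and contr: "\<And>y. y \<in> X \<Longrightarrow> norm (y - x - \<gamma> *\<^sub>R (S y - S x)) \<le> \<rho> * norm (y - x)"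
    and "y \<in> X"
  defines "step \<equiv> \<lambda>y. closest_point X (y - \<gamma> *\<^sub>R S y)"
  shows "(step ^^ n) y \<in> X \<and> norm ((step ^^ n) y - x) \<le> \<rho> ^ n * norm (y - x)"
proof (induction n)
  case 0
  show ?case using \<open>y \<in> X\<close> by simp
next
  case (Suc n)
  have x: "x \<in> X" and nonempty: "X \<noteq> {}"
    using vi \<open>y \<in> X\<close> by (auto simp: solves_vi_def)
  have fixed: "step x = x"
    using solves_vi_iff_projection_fixed[OF X x \<open>\<gamma> > 0\<close>] vi by (simp add: step_def)
  have "norm (step ((step ^^ n) y) - step x) \<le> \<rho> * norm ((step ^^ n) y - x)"
    using projected_step_lipschitz[OF X nonempty contr[of "(step ^^ n) y"]] Suc.IH
    by (simp add: step_def dist_norm)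
  also have "\<dots> \<le> \<rho> * (\<rho> ^ n * norm (y - x))"
    using Suc.IH \<open>\<rho> \<ge> 0\<close> by (intro mult_left_mono) auto
  finally have "norm (step ((step ^^ n) y) - x) \<le> \<rho> ^ Suc n * norm (y - x)"
    by (simp add: fixed)
  moreover have "step ((step ^^ n) y) \<in> X"
    using closest_point_in_set[OF X(2) nonempty] by (simp add: step_def)
  ultimately show ?case by simp
qed

text \<open>
  The set may be unbounded, so existence comes from Banach's fixed point theorem and not from
  compactness.
\<close>
lemma ex_solves_vi:
  fixes X :: "'a::euclidean_space set" and S :: "'a \<Rightarrow> 'a"
  assumes X: "convex X" "closed X" "X \<noteq> {}" and "\<gamma> > 0" "0 \<le> \<rho>" "\<rho> < 1"
    and contr: "\<And>x y. norm (y - x - \<gamma> *\<^sub>R (S y - S x)) \<le> \<rho> * norm (y - x)"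
  shows "\<exists>x. solves_vi X S x"
proof -
  have "\<exists>!x\<in>X. closest_point X (x - \<gamma> *\<^sub>R S x) = x"
    using X \<open>0 \<le> \<rho>\<close> \<open>\<rho> < 1\<close> closest_point_in_set[OF X(2,3)]
    by (intro Banach_fix[of _ \<rho>] projected_step_lipschitz contr)
      (auto simp: complete_eq_closed)
  then show ?thesis
    using solves_vi_iff_projection_fixed[OF X(1,2) _ \<open>\<gamma> > 0\<close>] by blast
qed

section \<open>Affine recursions and the rate\<close>

lemma affine_recursion_le:
  fixes e :: "nat \<Rightarrow> real"
  assumes "\<tau> \<noteq> 1" "\<tau> \<ge> 0" and rec: "\<And>k. e (Suc k) \<le> \<tau> * e k + b"
  shows "e k \<le> \<tau> ^ k * e 0 + b * ((1 - \<tau> ^ k) / (1 - \<tau>))"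
proof (induction k)
  case (Suc k)
  have "e (Suc k) \<le> \<tau> * (\<tau> ^ k * e 0 + b * ((1 - \<tau> ^ k) / (1 - \<tau>))) + b"
    using rec[of k] mult_left_mono[OF Suc.IH \<open>\<tau> \<ge> 0\<close>] by linarith
  also have "\<dots> = \<tau> ^ Suc k * e 0 + b * ((1 - \<tau> ^ Suc k) / (1 - \<tau>))"
    using \<open>\<tau> \<noteq> 1\<close> by (simp add: divide_simps) (simp add: algebra_simps)
  finally show ?case .
qed simp

lemma affine_recursion_limsup_le:
  fixes e :: "nat \<Rightarrow> real"
  assumes "0 \<le> \<tau>" "\<tau> < 1" and rec: "\<And>k. e (Suc k) \<le> \<tau> * e k + b"
  shows "limsup (\<lambda>k. ereal (e k)) \<le> ereal (b / (1 - \<tau>))"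
proof -
  define g where "g k = \<tau> ^ k * e 0 + b * ((1 - \<tau> ^ k) / (1 - \<tau>))" for k
  have "(\<lambda>k. \<tau> ^ k) \<longlonglongrightarrow> 0"
    using assms(1,2) by (intro LIMSEQ_power_zero) simp
  then have "g \<longlonglongrightarrow> 0 * e 0 + b * ((1 - 0) / (1 - \<tau>))"
    unfolding g_def using assms(1,2) by (intro tendsto_intros) auto
  then have "limsup (\<lambda>k. ereal (g k)) = ereal (b / (1 - \<tau>))"
    by (intro lim_imp_Limsup) auto
  moreover have "limsup (\<lambda>k. ereal (e k)) \<le> limsup (\<lambda>k. ereal (g k))"
    using affine_recursion_le[of \<tau> e b] assms
    by (intro Limsup_mono always_eventually) (auto simp: g_def)
  ultimately show ?thesis by simp
qed

lemma tau0_nonneg: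
  assumes "0 < m" "m \<le> L"
  shows "0 \<le> tau0 m L \<alpha> \<beta> P C"
  unfolding tau0_def using assms
  by (intro mult_nonneg_nonneg add_nonneg_nonneg zero_le_power contraction_rate_nonneg) auto

text \<open>
  Without corrections \<open>tau0\<close> is at least \<open>2 L / m \<ge> 2\<close>.
\<close>
lemma tau0_less_1_imp_correction:
  assumes "0 < m" "m \<le> L" "tau0 m L \<alpha> \<beta> P C < 1"
  shows "C > 0"
proof (rule ccontr)
  define p where "p = contraction_rate \<alpha> m L ^ P"
  assume "\<not> C > 0"
  then have "p + (p + 1) * (2 * L / m) < 1"
    using assms(3) by (simp add: tau0_def p_def)
  moreover have "0 \<le> p"
    by (simp add: p_def contraction_rate_nonneg)
  moreover have "2 \<le> 2 * L / m"
    using assms by (simp add: field_simps)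
  moreover have "1 * 2 \<le> (p + 1) * (2 * L / m)"
    using calculation by (intro mult_mono) auto
  ultimately show False by linarith
qed

lemma tau0_uniform_gap:
  assumes "0 < m" "m \<le> L" "contraction_rate \<beta> m L \<le> 1"
  obtains \<delta> where "\<delta> > 0" "\<And>C. tau0 m L \<alpha> \<beta> P C < 1 \<Longrightarrow> tau0 m L \<alpha> \<beta> P C \<le> 1 - \<delta>"
proof (cases "\<exists>C. tau0 m L \<alpha> \<beta> P C < 1")
  case True
  define C\<^sub>0 where "C\<^sub>0 = (LEAST C. tau0 m L \<alpha> \<beta> P C < 1)"
  have "tau0 m L \<alpha> \<beta> P C\<^sub>0 < 1"
    unfolding C\<^sub>0_def using True by (rule LeastI_ex)
  moreover have "tau0 m L \<alpha> \<beta> P C \<le> tau0 m L \<alpha> \<beta> P C\<^sub>0" if "tau0 m L \<alpha> \<beta> P C < 1" for C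
  proof -
    have "C\<^sub>0 \<le> C"
      unfolding C\<^sub>0_def using that by (rule Least_le)
    then show ?thesis
      unfolding tau0_def using assms
      by (intro mult_right_mono power_decreasing add_nonneg_nonneg mult_nonneg_nonneg
          zero_le_power contraction_rate_nonneg) auto
  qed
  ultimately show ?thesis
    using that[of "1 - tau0 m L \<alpha> \<beta> P C\<^sub>0"] by simp
next
  case False
  then show ?thesis using that[of 1] by simp
qed

section \<open>Tracking a moving optimizer\<close>

text \<open>
  The objective enters the analysis only through its gradient: the optimizer is characterized by
  the variational inequality of \<open>G\<close>.
\<close>
locale tracking_problem =
  fixes X :: "(real^'n) set"
    and G :: "real^'n \<Rightarrow> real \<Rightarrow> real^'n"
    and H :: "real^'n \<Rightarrow> real \<Rightarrow> real^'n^'n"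
    and D :: "real^'n \<Rightarrow> real \<Rightarrow> real^'n"
    and xstar :: "real \<Rightarrow> real^'n"
    and m L C0 :: real
  assumes convex: "convex X" and closed: "closed X"
    and hessian: "\<And>x t. t \<ge> 0 \<Longrightarrow> ((\<lambda>y. G y t) has_derivative (\<lambda>v. H x t *v v)) (at x)"
    and gradient_dt: "\<And>x t. t \<ge> 0 \<Longrightarrow> (G x has_vector_derivative D x t) (at t within {0..})"
    and m_pos: "m > 0"
    and strongly_convex: "\<And>x t. x \<in> X \<Longrightarrow> t \<ge> 0 \<Longrightarrow> psd (H x t - mat m)"
    and hessian_bound: "\<And>x t. x \<in> X \<Longrightarrow> t \<ge> 0 \<Longrightarrow> onorm (\<lambda>v. H x t *v v) \<le> L"
    and gradient_dt_bound: "\<And>x t. x \<in> X \<Longrightarrow> t \<ge> 0 \<Longrightarrow> norm (D x t) \<le> C0"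
    and optimizer: "\<And>t. t \<ge> 0 \<Longrightarrow> solves_vi X (\<lambda>y. G y t) (xstar t)"
begin

lemma xstar_in_X: "t \<ge> 0 \<Longrightarrow> xstar t \<in> X"
  using optimizer by (simp add: solves_vi_def)

lemma X_nonempty: "X \<noteq> {}"
  using xstar_in_X[of 0] by auto

lemma m_le_L: "m \<le> L"
proof -
  define v :: "real^'n" where "v = axis undefined 1"
  have v: "norm v = 1"
    by (simp add: v_def norm_axis_1)
  have "m \<le> v \<bullet> (H (xstar 0) 0 *v v)"
    using psd_diff_matD(2)[OF strongly_convex[OF xstar_in_X[OF order_refl] order_refl], of v] v by simp
  also have "\<dots> \<le> norm (H (xstar 0) 0 *v v)"
    using norm_cauchy_schwarz[of v "H (xstar 0) 0 *v v"] v by simp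
  also have "\<dots> \<le> L"
    using norm_matrix_vector_le[OF hessian_bound[OF xstar_in_X[OF order_refl] order_refl], of v] v by simp
  finally show ?thesis .
qed

lemma L_pos: "L > 0"
  using m_pos m_le_L by linarith

lemma C0_nonneg: "C0 \<ge> 0"
  using gradient_dt_bound[of "xstar 0" 0] xstar_in_X[of 0]
  by (meson norm_ge_zero order_refl order_trans)

lemma gradient_step_contraction:
  assumes "x \<in> X" "y \<in> X" "t \<ge> 0" "\<gamma> \<ge> 0"
  shows "norm (y - x - \<gamma> *\<^sub>R (G y t - G x t)) \<le> contraction_rate \<gamma> m L * norm (y - x)"
proof -
  have "norm ((y - \<gamma> *\<^sub>R G y t) - (x - \<gamma> *\<^sub>R G x t)) \<le> contraction_rate \<gamma> m L * norm (y - x)"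
  proof (rule differentiable_bound[OF convex])
    fix z assume z: "z \<in> X"
    show "((\<lambda>z. z - \<gamma> *\<^sub>R G z t) has_derivative (\<lambda>v. v - \<gamma> *\<^sub>R (H z t *v v))) (at z within X)"
      by (intro has_derivative_diff has_derivative_ident has_derivative_scaleR_right
          has_derivative_at_withinI[OF hessian] assms)
    show "onorm (\<lambda>v. v - \<gamma> *\<^sub>R (H z t *v v)) \<le> contraction_rate \<gamma> m L"
      by (intro onorm_le gradient_step_norm_le strongly_convex hessian_bound z assms)
  qed (use assms in auto)
  then show ?thesis
    by (simp add: algebra_simps)
qed

lemma gradient_lipschitz:
  assumes "x \<in> X" "y \<in> X" "t \<ge> 0"
  shows "norm (G y t - G x t) \<le> L * norm (y - x)"
proof (rule differentiable_bound[OF convex])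
  fix z assume z: "z \<in> X"
  show "((\<lambda>z. G z t) has_derivative (\<lambda>v. H z t *v v)) (at z within X)"
    using hessian[OF \<open>t \<ge> 0\<close>] by (rule has_derivative_at_withinI)
  show "onorm (\<lambda>v. H z t *v v) \<le> L"
    by (intro hessian_bound z assms)
qed (use assms in auto)

lemma gradient_time_lipschitz:
  assumes "x \<in> X" "s \<ge> 0" "t \<ge> 0"
  shows "norm (G x t - G x s) \<le> C0 * \<bar>t - s\<bar>"
proof -
  have "norm (G x t - G x s) \<le> C0 * norm (t - s)"
  proof (rule differentiable_bound[where S = "{0..}"])
    fix r :: real assume r: "r \<in> {0..}"
    show "(G x has_derivative (\<lambda>v. v *\<^sub>R D x r)) (at r within {0..})"
      using gradient_dt[of r x] r by (simp add: has_vector_derivative_def)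
    show "onorm (\<lambda>v. v *\<^sub>R D x r) \<le> C0"
      using gradient_dt_bound[OF \<open>x \<in> X\<close>, of r] r
      by (intro onorm_le) (auto simp: mult.commute[of C0] intro!: mult_left_mono)
  qed (use assms in auto)
  then show ?thesis by simp
qed

text \<open>
  Step sizes \<open>\<gamma>\<close> that are too large have a contraction rate above \<open>1 - \<gamma> m\<close>; with \<open>\<gamma> = 1 / L\<close> the two
  are equal, and \<open>strongly_monotone_if_contraction\<close> turns the contraction into monotonicity.
\<close>
lemma gradient_strongly_monotone:
  assumes "x \<in> X" "y \<in> X" "t \<ge> 0"
  shows "m * (norm (y - x))\<^sup>2 \<le> (G y t - G x t) \<bullet> (y - x)"
proof (rule strongly_monotone_if_contraction)
  show "1 / L > 0"
    using L_pos by simp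
  have "contraction_rate (1 / L) m L = 1 - 1 / L * m"
    using L_pos m_le_L by (simp add: contraction_rate_def)
  then show "norm (y - x - (1 / L) *\<^sub>R (G y t - G x t)) \<le> (1 - 1 / L * m) * norm (y - x)"
    using gradient_step_contraction[OF assms, of "1 / L"] L_pos by simp
qed

lemma optimizer_drift:
  assumes "s \<ge> 0" "t \<ge> 0"
  shows "norm (xstar t - xstar s) \<le> C0 * \<bar>t - s\<bar> / m"
proof -
  have "m * norm (xstar t - xstar s) \<le> norm (G (xstar s) s - G (xstar s) t)"
    using assms
    by (intro vi_solution_perturbation[OF optimizer optimizer] gradient_strongly_monotone xstar_in_X)
  also have "\<dots> \<le> C0 * \<bar>t - s\<bar>"
    using gradient_time_lipschitz[OF xstar_in_X, of s t s] assms by (simp add: abs_minus_commute)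
  finally show ?thesis
    using m_pos by (simp add: field_simps)
qed

section \<open>One sampling period\<close>

definition model_gradient :: "real \<Rightarrow> real^'n \<Rightarrow> real \<Rightarrow> real^'n \<Rightarrow> real^'n" where
  "model_gradient h x t y = H x t *v (y - x) + h *\<^sub>R D x t + G x t"

lemma model_gradient_diff:
  "model_gradient h x t y - model_gradient h x t z = H x t *v (y - z)"
  by (simp add: model_gradient_def algebra_simps)

lemma model_gradient_error:
  assumes "x \<in> X" "y \<in> X" "t \<ge> 0" "h \<ge> 0"
  shows "norm (G y (t + h) - model_gradient h x t y) \<le> 2 * L * norm (y - x) + 2 * C0 * h"
proof -
  have "G y (t + h) - model_gradient h x t y =
      (G y (t + h) - G y t) + (G y t - G x t) - H x t *v (y - x) - h *\<^sub>R D x t"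
    by (simp add: model_gradient_def)
  then have "norm (G y (t + h) - model_gradient h x t y) \<le>
      norm (G y (t + h) - G y t) + norm (G y t - G x t) + norm (H x t *v (y - x)) + norm (h *\<^sub>R D x t)"
    by (smt (verit) norm_triangle_ineq norm_triangle_ineq4)
  moreover have "norm (G y (t + h) - G y t) \<le> C0 * h"
    using gradient_time_lipschitz[of y t "t + h"] assms by simp
  moreover have "norm (G y t - G x t) \<le> L * norm (y - x)"
    using gradient_lipschitz assms by simp
  moreover have "norm (H x t *v (y - x)) \<le> L * norm (y - x)"
    by (intro norm_matrix_vector_le hessian_bound assms)
  moreover have "norm (h *\<^sub>R D x t) \<le> C0 * h"
    using gradient_dt_bound[of x t] assms by (simp add: mult.commute[of C0] mult_left_mono)
  ultimately show ?thesis by linarith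
qed

text \<open>
  The prediction contracts towards the exact solution \<open>z\<close> of the model problem and not towards the
  new optimizer; the detour through \<open>z\<close> costs the distance from \<open>z\<close> to the optimizer twice, once
  damped by the prediction steps and once in full.
\<close>
lemma prediction_error:
  fixes P :: nat
  assumes x: "x \<in> X" and t: "t \<ge> 0" and h: "h \<ge> 0" and \<alpha>: "0 < \<alpha>" "\<alpha> < 2 / L"
  defines "p \<equiv> contraction_rate \<alpha> m L ^ P"
  defines "y \<equiv> (prediction_step X G H D \<alpha> h x t ^^ P) x"
  shows "y \<in> X"
    and "norm (y - xstar (t + h)) \<le>
      (p + (p + 1) * (2 * L / m)) * norm (x - xstar (t + h)) + (p + 1) * (2 * C0 * h / m)"
proof -
  let ?Q = "model_gradient h x t" and ?x' = "xstar (t + h)"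
  have contr: "norm (u - v - \<alpha> *\<^sub>R (?Q u - ?Q v)) \<le> contraction_rate \<alpha> m L * norm (u - v)" for u v
    unfolding model_gradient_diff using x t \<alpha>
    by (intro gradient_step_norm_le strongly_convex hessian_bound) auto
  obtain z where z: "solves_vi X ?Q z"
    using ex_solves_vi[OF convex closed X_nonempty \<alpha>(1) contraction_rate_nonneg
        contraction_rate_less_1[OF m_pos m_le_L \<alpha>] contr] by blast
  have y_alt: "y = ((\<lambda>y. closest_point X (y - \<alpha> *\<^sub>R ?Q y)) ^^ P) x"
    by (simp add: y_def prediction_step_def[abs_def] model_gradient_def)
  show "y \<in> X"
    using projected_steps_contract[OF convex closed \<alpha>(1) contraction_rate_nonneg z contr x]
    unfolding y_alt by blast
  have y: "norm (y - z) \<le> p * norm (x - z)"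
    using projected_steps_contract[OF convex closed \<alpha>(1) contraction_rate_nonneg z contr x]
    unfolding y_alt p_def by blast
  have "m * norm (z - ?x') \<le> norm (G ?x' (t + h) - ?Q ?x')"
    using t h psd_diff_matD(2)[OF strongly_convex[OF x t]]
    by (intro vi_solution_perturbation[OF z optimizer]) (auto simp: model_gradient_diff inner_commute)
  also have "\<dots> \<le> 2 * L * norm (?x' - x) + 2 * C0 * h"
    using x t h by (intro model_gradient_error xstar_in_X) auto
  finally have z_error: "norm (z - ?x') \<le> 2 * L / m * norm (x - ?x') + 2 * C0 * h / m"
    using m_pos by (simp add: field_simps norm_minus_commute)
  have p: "p \<ge> 0"
    by (simp add: p_def contraction_rate_nonneg)
  have "norm (y - ?x') \<le> norm (y - z) + norm (z - ?x')"
    using norm_triangle_ineq[of "y - z" "z - ?x'"] by simp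
  also have "\<dots> \<le> p * (norm (x - ?x') + norm (z - ?x')) + norm (z - ?x')"
  proof -
    have "norm (x - z) \<le> norm (x - ?x') + norm (z - ?x')"
      using norm_triangle_ineq4[of "x - ?x'" "z - ?x'"] by simp
    then show ?thesis
      using y mult_left_mono[OF _ p] by fastforce
  qed
  also have "\<dots> = p * norm (x - ?x') + (p + 1) * norm (z - ?x')"
    by (simp add: algebra_simps)
  also have "\<dots> \<le> p * norm (x - ?x') + (p + 1) * (2 * L / m * norm (x - ?x') + 2 * C0 * h / m)"
    using p z_error by (intro add_left_mono mult_left_mono) auto
  finally show "norm (y - ?x') \<le>
      (p + (p + 1) * (2 * L / m)) * norm (x - ?x') + (p + 1) * (2 * C0 * h / m)"
    by (simp add: algebra_simps)
qed

text \<open>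
  In the offset, the first summand of the bracket is the drift of the optimizer carried through the
  factor that \<open>tau0\<close> applies to the old error, the second one the time error of the model.
\<close>
lemma error_step:
  fixes P C :: nat
  assumes x: "x \<in> X" and t: "t \<ge> 0" and h: "h \<ge> 0"
    and \<alpha>: "0 < \<alpha>" "\<alpha> < 2 / L" and \<beta>: "0 < \<beta>"
  defines "p \<equiv> contraction_rate \<alpha> m L ^ P"
  defines "y \<equiv> (correction_step X G \<beta> (t + h) ^^ C) ((prediction_step X G H D \<alpha> h x t ^^ P) x)"
  shows "y \<in> X"
    and "norm (y - xstar (t + h)) \<le> tau0 m L \<alpha> \<beta> P C * norm (x - xstar t) +
      contraction_rate \<beta> m L ^ C * h *
        ((p + (p + 1) * (2 * L / m)) * (C0 / m) + (p + 1) * (2 * C0 / m))"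
proof -
  let ?y = "(prediction_step X G H D \<alpha> h x t ^^ P) x" and ?x' = "xstar (t + h)"
  let ?q = "p + (p + 1) * (2 * L / m)" and ?c = "contraction_rate \<beta> m L ^ C"
  have t': "t + h \<ge> 0"
    using t h by simp
  have contr: "norm (u - ?x' - \<beta> *\<^sub>R (G u (t + h) - G ?x' (t + h)))
      \<le> contraction_rate \<beta> m L * norm (u - ?x')" if "u \<in> X" for u
    using that \<beta> t' by (intro gradient_step_contraction xstar_in_X) auto
  have correction: "y \<in> X \<and> norm (y - ?x') \<le> ?c * norm (?y - ?x')"
    using projected_steps_contract[OF convex closed \<beta> contraction_rate_nonneg optimizer[OF t'] contr
        prediction_error(1)[OF x t h \<alpha>]]
    unfolding y_def correction_step_def[abs_def] by blast
  then show "y \<in> X" by blast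
  have p: "p \<ge> 0"
    by (simp add: p_def contraction_rate_nonneg)
  have q: "?q \<ge> 0"
    using p L_pos m_pos by simp
  have "norm (x - ?x') \<le> norm (x - xstar t) + norm (?x' - xstar t)"
    using norm_triangle_ineq4[of "x - xstar t" "?x' - xstar t"] by simp
  also have "\<dots> \<le> norm (x - xstar t) + C0 * h / m"
    using optimizer_drift[OF t t'] h by simp
  finally have "?q * norm (x - ?x') \<le> ?q * (norm (x - xstar t) + C0 * h / m)"
    using q by (rule mult_left_mono)
  then have "norm (?y - ?x') \<le> ?q * (norm (x - xstar t) + C0 * h / m) + (p + 1) * (2 * C0 * h / m)"
    using prediction_error(2)[OF x t h \<alpha>, of P, folded p_def] by linarith
  then have "?c * norm (?y - ?x') \<le>
      ?c * (?q * (norm (x - xstar t) + C0 * h / m) + (p + 1) * (2 * C0 * h / m))"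
    by (intro mult_left_mono zero_le_power contraction_rate_nonneg)
  also have "\<dots> = ?c * ?q * norm (x - xstar t) +
      ?c * h * (?q * (C0 / m) + (p + 1) * (2 * C0 / m))"
    by (simp add: ring_distribs add_divide_distrib mult_ac)
  finally show "norm (y - ?x') \<le> tau0 m L \<alpha> \<beta> P C * norm (x - xstar t) +
      ?c * h * (?q * (C0 / m) + (p + 1) * (2 * C0 / m))"
    using correction by (simp add: tau0_def p_def)
qed

lemma cfopc_in_X_step:
  assumes "C > 0"
  shows "cfopc X G H D \<alpha> \<beta> P C h ts x0 (Suc k) \<in> X"
proof -
  obtain C' where "C = Suc C'"
    using assms by (cases C) auto
  then show ?thesis
    using closest_point_in_set[OF closed X_nonempty] by (simp add: Let_def correction_step_def)
qed

lemma cfopc_error_step: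
  fixes ts :: "nat \<Rightarrow> real"
  assumes xk: "cfopc X G H D \<alpha> \<beta> P C h ts x0 k \<in> X"
    and h: "h \<ge> 0" and ts: "ts 0 \<ge> 0" "\<And>k. ts (Suc k) - ts k = h"
    and \<alpha>: "0 < \<alpha>" "\<alpha> < 2 / L" and \<beta>: "0 < \<beta>"
  defines "p \<equiv> contraction_rate \<alpha> m L ^ P"
  defines "e \<equiv> \<lambda>k. norm (cfopc X G H D \<alpha> \<beta> P C h ts x0 k - xstar (ts k))"
  shows "e (Suc k) \<le> tau0 m L \<alpha> \<beta> P C * e k + contraction_rate \<beta> m L ^ C * h *
        ((p + (p + 1) * (2 * L / m)) * (C0 / m) + (p + 1) * (2 * C0 / m))"
proof -
  have Suc: "ts (Suc j) = ts j + h" for j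
    using ts(2)[of j] by simp
  have "ts k \<ge> 0"
    by (induction k) (use ts(1) h in \<open>auto simp: Suc\<close>)
  then show ?thesis
    using error_step(2)[OF xk _ h \<alpha> \<beta>, of "ts k" C P]
    by (simp add: e_def p_def Let_def Suc)
qed

end

section \<open>Convergence of the method\<close>

theorem theorem1:
  fixes X :: "(real^'n) set"
    and f :: "real^'n \<Rightarrow> real \<Rightarrow> real"
    and G :: "real^'n \<Rightarrow> real \<Rightarrow> real^'n"
    and H :: "real^'n \<Rightarrow> real \<Rightarrow> real^'n^'n"
    and D :: "real^'n \<Rightarrow> real \<Rightarrow> real^'n"
    and xstar :: "real \<Rightarrow> real^'n"
    and m L C0 \<alpha> \<beta> :: real
    and P :: nat
  assumes "convex X" and "closed X"
    and gradient: "\<And>x t. t \<ge> 0 \<Longrightarrow> GDERIV (\<lambda>y. f y t) x :> G x t"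
    and hessian: "\<And>x t. t \<ge> 0 \<Longrightarrow> ((\<lambda>y. G y t) has_derivative (\<lambda>v. H x t *v v)) (at x)"
    and gradient_dt: "\<And>x t. t \<ge> 0 \<Longrightarrow> (G x has_vector_derivative D x t) (at t within {0..})"
    and "m > 0"
    and strongly_convex: "\<And>x t. x \<in> X \<Longrightarrow> t \<ge> 0 \<Longrightarrow> psd (H x t - mat m)"
    and hessian_bound: "\<And>x t. x \<in> X \<Longrightarrow> t \<ge> 0 \<Longrightarrow> onorm (\<lambda>v. H x t *v v) \<le> L"
    and gradient_dt_bound: "\<And>x t. x \<in> X \<Longrightarrow> t \<ge> 0 \<Longrightarrow> norm (D x t) \<le> C0"
    and optimizer: "\<And>t. t \<ge> 0 \<Longrightarrow> is_arg_min (\<lambda>y. f y t) (\<lambda>y. y \<in> X) (xstar t)"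
    and "\<alpha> > 0" and "\<alpha> < 2 / L" and "\<beta> > 0" and "\<beta> < 2 / L"
  shows "\<exists>K\<ge>0. \<forall>(h::real) (C::nat) (ts::nat \<Rightarrow> real) x0.
     h > 0 \<longrightarrow> ts 0 \<ge> 0 \<longrightarrow> (\<forall>k. ts (Suc k) - ts k = h) \<longrightarrow> tau0 m L \<alpha> \<beta> P C < 1 \<longrightarrow>
     (let e = (\<lambda>k. norm (cfopc X G H D \<alpha> \<beta> P C h ts x0 k - xstar (ts k)));
          bound = K * (contraction_rate \<beta> m L ^ C * h)
      in (x0 \<in> X \<longrightarrow> (\<exists>E\<le>bound. converges_linearly_to_bound e (tau0 m L \<alpha> \<beta> P C) E)) \<and>
         limsup (\<lambda>k. ereal (e k)) \<le> ereal bound)"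
proof -
  have "solves_vi X (\<lambda>y. G y t) (xstar t)" if "t \<ge> 0" for t
    using minimizer_solves_vi[OF \<open>convex X\<close> _ optimizer[OF that], of "\<lambda>y. G y t"]
      gradient[OF that] by blast
  then interpret tracking_problem X G H D xstar m L C0
    using assms by unfold_locales auto
  have \<alpha>: "0 < \<alpha>" "\<alpha> < 2 / L" and \<beta>: "0 < \<beta>" "\<beta> < 2 / L"
    by fact+
  let ?\<rho> = "contraction_rate \<beta> m L"
  define p where "p = contraction_rate \<alpha> m L ^ P"
  define B where "B = (p + (p + 1) * (2 * L / m)) * (C0 / m) + (p + 1) * (2 * C0 / m)"
  have "p \<ge> 0"
    by (simp add: p_def contraction_rate_nonneg)
  then have B: "B \<ge> 0"
    using m_pos L_pos C0_nonneg by (simp add: B_def)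
  obtain \<delta> where \<delta>: "\<delta> > 0" "\<And>C. tau0 m L \<alpha> \<beta> P C < 1 \<Longrightarrow> tau0 m L \<alpha> \<beta> P C \<le> 1 - \<delta>"
    using tau0_uniform_gap[OF m_pos m_le_L less_imp_le[OF contraction_rate_less_1[OF m_pos m_le_L \<beta>]]]
    by blast
  show ?thesis
  proof (rule exI[of _ "B / \<delta>"], intro conjI allI impI)
    show "B / \<delta> \<ge> 0"
      using B \<delta>(1) by simp
    fix h :: real and C :: nat and ts :: "nat \<Rightarrow> real" and x0
    assume h: "h > 0" and ts: "ts 0 \<ge> 0" "\<forall>k. ts (Suc k) - ts k = h"
      and \<tau>_less: "tau0 m L \<alpha> \<beta> P C < 1"
    define e where "e = (\<lambda>k. norm (cfopc X G H D \<alpha> \<beta> P C h ts x0 k - xstar (ts k)))"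
    define \<tau> where "\<tau> = tau0 m L \<alpha> \<beta> P C"
    define b where "b = ?\<rho> ^ C * h * B"
    have \<tau>: "0 \<le> \<tau>" "\<tau> < 1" "\<tau> \<le> 1 - \<delta>"
      using tau0_nonneg[OF m_pos m_le_L] \<tau>_less \<delta>(2) by (auto simp: \<tau>_def)
    have b: "b \<ge> 0"
      using B h by (simp add: b_def contraction_rate_nonneg)
    have "b / (1 - \<tau>) \<le> b / \<delta>"
      using b \<tau>(3) \<delta>(1) by (intro divide_left_mono) auto
    then have bound: "b / (1 - \<tau>) \<le> B / \<delta> * (?\<rho> ^ C * h)"
      by (simp add: b_def mult_ac)
    (* the Lipschitz and curvature bounds hold on X only, hence the condition on the iterate *)
    have step: "e (Suc k) \<le> \<tau> * e k + b" if "cfopc X G H D \<alpha> \<beta> P C h ts x0 k \<in> X" for k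
      using cfopc_error_step[OF that less_imp_le[OF h] ts(1) _ \<alpha> \<beta>(1)] ts(2)
      by (simp add: e_def \<tau>_def b_def B_def p_def)
    have later_in_X: "cfopc X G H D \<alpha> \<beta> P C h ts x0 (Suc k) \<in> X" for k
      using tau0_less_1_imp_correction[OF m_pos m_le_L \<tau>_less] by (rule cfopc_in_X_step)
    have "\<exists>E\<le>B / \<delta> * (?\<rho> ^ C * h). converges_linearly_to_bound e \<tau> E" if "x0 \<in> X"
    proof (intro exI conjI)
      have "e (Suc k) \<le> \<tau> * e k + b" for k
        using step later_in_X that by (cases k) (simp_all del: cfopc.simps(2))
      then show "converges_linearly_to_bound e \<tau> (b / (1 - \<tau>))"
        unfolding converges_linearly_to_bound_def
        using \<tau> b affine_recursion_le[of \<tau> e b] by auto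
    qed (rule bound)
    moreover have "limsup (\<lambda>k. ereal (e k)) \<le> ereal (B / \<delta> * (?\<rho> ^ C * h))"
    proof -
      have "limsup (\<lambda>k. ereal (e (Suc k))) \<le> ereal (b / (1 - \<tau>))"
        using affine_recursion_limsup_le[of \<tau> "\<lambda>k. e (Suc k)"] step[OF later_in_X] \<tau> by blast
      then show ?thesis
        using bound limsup_shift[of "\<lambda>k. ereal (e k)"] order_trans by fastforce
    qed
    ultimately show "let e = (\<lambda>k. norm (cfopc X G H D \<alpha> \<beta> P C h ts x0 k - xstar (ts k)));
          bound = B / \<delta> * (?\<rho> ^ C * h)
      in (x0 \<in> X \<longrightarrow> (\<exists>E\<le>bound. converges_linearly_to_bound e (tau0 m L \<alpha> \<beta> P C) E)) \<and>
         limsup (\<lambda>k. ereal (e k)) \<le> ereal bound"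
      unfolding Let_def e_def[symmetric] \<tau>_def[symmetric] by blast
  qed
qed

end
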